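(* Let $\mathcal{P}$ be a hereditary permutation property. For every real $\varepsilon_0>0$ there exists a real $\delta_0>0$ such that every permutation $\pi$ satisfying $\mathrm{dist}_\square(\pi,\mathcal{P})<\delta_0$ also satisfies $\mathrm{dist}_K(\pi,\mathcal{P})<\varepsilon_0$.
   Context: $[N]$ denotes $\{1,\ldots,N\}$. A permutation of order $N$ is a bijection $\pi:[N]\to[N]$; its order is denoted $|\pi|$. If $\pi$ is a permutation of order $N$ and $X=\{x_1<\cdots<x_{|X|}\}\subseteq[N]$, the subpermutation of $\pi$ induced by $X$ is the permutation $\pi'$ of order $|X|$ such that $\pi'(i)<\pi'(j)$ if and only if $\pi(x_i)<\pi(x_j)$ for all $i,j\in[|X|]$. A permutation property $\mathcal{P}$ is a set of permutations. It is hereditary if every subpermutation of every $\pi\in\mathcal{P}$ is in $\mathcal{P}$. For permutations $\pi,\sigma$ of the same order $N$, the rectangular distance is $$\mathrm{dist}_\square(\pi,\sigma)=\max_{S,T}\frac{\big||\pi(S)\cap T|-|\sigma(S)\cap T|\big|}{N},$$ where the maximum is over all subintervals $S$ and $T$ (sets of consecutive integers) of $[N]$, and the Kendall's tau distance is $$\mathrm{dist}_K(\pi,\sigma)=\frac{|\{(i,j)\in[N]\times[N] : \pi(i)<\pi(j),\ \sigma(i)>\sigma(j)\}|}{\binom N2}$$ (taken to be $0$ if $N=1$). Further, $\mathrm{dist}_\square(\pi,\mathcal{P})=\min_{\sigma\in\mathcal{P},\,|\sigma|=|\pi|}\mathrm{dist}_\square(\pi,\sigma)$ and $\mathrm{dist}_K(\pi,\mathcal{P})=\min_{\sigma\in\mathcal{P},\,|\sigma|=|\pi|}\mathrm{dist}_K(\pi,\sigma)$,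 where the minimum over the empty set is $+\infty$. *)

theory Defs
  imports Complex_Main "HOL-Combinatorics.Permutations" "HOL-Library.Extended_Real"
begin

text \<open>
  A permutation of order \<open>N \<ge> 1\<close> is encoded as a pair \<open>(N, p)\<close>. The condition \<open>p permutes {1..N}\<close>
  makes \<open>p\<close> the identity outside \<open>{1..N}\<close>, so each bijection of \<open>{1..N}\<close> has exactly one encoding.
  The order is part of the encoding because the function \<open>p\<close> does not determine it.
\<close>

type_synonym perm = "nat \<times> (nat \<Rightarrow> nat)"

definition permutations :: "perm set" where
  "permutations = {(N, p). N \<ge> 1 \<and> p permutes {1..N}}"

definition perm_order :: "perm \<Rightarrow> nat" where
  "perm_order \<pi> = fst \<pi>"

definition app :: "perm \<Rightarrow> nat \<Rightarrow> nat" where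
  "app \<pi> = snd \<pi>"

text \<open>
  \<open>nth_elem X i\<close> is the \<open>i\<close>-th smallest element of the finite set \<open>X\<close>, for \<open>i \<in> {1..card X}\<close>
  (list positions start at \<open>0\<close>).
\<close>

definition nth_elem :: "nat set \<Rightarrow> nat \<Rightarrow> nat" where
  "nth_elem X i = sorted_list_of_set X ! (i - 1)"

text \<open>
  Since all permutations have positive order, a set \<open>X\<close> inducing a subpermutation is nonempty.
\<close>

definition induced_subperm :: "perm \<Rightarrow> nat set \<Rightarrow> perm \<Rightarrow> bool" where
  "induced_subperm \<pi> X \<pi>' \<longleftrightarrow>
     X \<subseteq> {1..perm_order \<pi>} \<and> \<pi>' \<in> permutations \<and> perm_order \<pi>' = card X \<and>
     (\<forall>i\<in>{1..card X}. \<forall>j\<in>{1..card X}.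
        app \<pi>' i < app \<pi>' j \<longleftrightarrow> app \<pi> (nth_elem X i) < app \<pi> (nth_elem X j))"

definition permutation_property :: "perm set \<Rightarrow> bool" where
  "permutation_property \<P> \<longleftrightarrow> \<P> \<subseteq> permutations"

definition hereditary :: "perm set \<Rightarrow> bool" where
  "hereditary \<P> \<longleftrightarrow> (\<forall>\<pi>\<in>\<P>. \<forall>X \<pi>'. induced_subperm \<pi> X \<pi>' \<longrightarrow> \<pi>' \<in> \<P>)"

text \<open>
  The empty set counts as a subinterval here (take \<open>a > b\<close>). It only adds the value \<open>0\<close> to the
  maximum below, and \<open>S = T = {1..N}\<close> already attains that value.
\<close>

definition subintervals :: "nat \<Rightarrow> nat set set" where
  "subintervals N = {{a..b} | a b. 1 \<le> a \<and> b \<le> N}"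

text \<open>
  Both distances below are meant for permutations of equal order.
\<close>

definition dist_rect :: "perm \<Rightarrow> perm \<Rightarrow> real" where
  "dist_rect \<pi> \<sigma> =
     Max {\<bar>real (card (app \<pi> ` S \<inter> T)) - real (card (app \<sigma> ` S \<inter> T))\<bar> / real (perm_order \<pi>) | S T.
            S \<in> subintervals (perm_order \<pi>) \<and> T \<in> subintervals (perm_order \<pi>)}"

text \<open>
  For order \<open>1\<close> the binomial coefficient is \<open>0\<close>, and division by zero gives the conventional value \<open>0\<close>.
\<close>

definition dist_kendall :: "perm \<Rightarrow> perm \<Rightarrow> real" where
  "dist_kendall \<pi> \<sigma> =
     real (card {(i, j). i \<in> {1..perm_order \<pi>} \<and> j \<in> {1..perm_order \<pi>} \<and>
                         app \<pi> i < app \<pi> j \<and> app \<sigma> i > app \<sigma> j})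
       / real (perm_order \<pi> choose 2)"

text \<open>
  The infima range over finite sets, as there are only finitely many permutations of a given order,
  so they are minima; over the empty set they are \<open>\<infinity>\<close>.
\<close>

definition dist_rect_prop :: "perm \<Rightarrow> perm set \<Rightarrow> ereal" where
  "dist_rect_prop \<pi> \<P> = (INF \<sigma>\<in>{\<sigma>\<in>\<P>. perm_order \<sigma> = perm_order \<pi>}. ereal (dist_rect \<pi> \<sigma>))"

definition dist_kendall_prop :: "perm \<Rightarrow> perm set \<Rightarrow> ereal" where
  "dist_kendall_prop \<pi> \<P> = (INF \<sigma>\<in>{\<sigma>\<in>\<P>. perm_order \<sigma> = perm_order \<pi>}. ereal (dist_kendall \<pi> \<sigma>))"

end

theory Submission
  imports Defs "HOL-Library.Sublist" "HOL-Library.Multiset"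
begin

text \<open>
  Cut the range of a permutation into at most \<open>k\<close> rows and record the row of each value; this turns
  permutations into words over \<open>{..<k}\<close>, and a word determines its permutation up to a Kendall error
  \<open>O(1/k)\<close>. The subsequences of the row words of \<open>\<P>\<close> form a subsequence-closed language \<open>L\<close>, and, \<open>\<P>\<close>
  being hereditary, each word of \<open>L\<close> is respected by a permutation in \<open>\<P>\<close> of the same length.
  By Jullien's theorem \<open>L\<close> is a finite union of products of languages \<open>B\<^sup>*\<close> and single letters.
  If the row word of \<open>\<sigma> \<in> \<P>\<close> lies in such a product and \<open>\<pi>\<close> is rectangularly close to \<open>\<sigma>\<close>, then on the
  interval of each factor \<open>B\<^sup>*\<close> the word of \<open>\<pi>\<close> has few letters outside \<open>B\<close>. Changing these gives
  a word of the same product, hence of \<open>L\<close>, at small Hamming distance. The bound on the number of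
  factors depends only on \<open>\<P>\<close> and \<open>k\<close>, and so does the resulting \<open>\<delta>\<^sub>0\<close>.
\<close>

section \<open>Decomposition of subsequence-closed languages\<close>

text \<open>\<open>Letter\<close> is matched exactly, not optionally, so the language of a single
  product need not be subsequence-closed; the decomposition only needs it to lie inside the closed
  language.\<close>

datatype 'a factor = Letter 'a | Star "'a set"

fun lang :: "'a factor list \<Rightarrow> 'a list set" where
  "lang [] = {[]}"
| "lang (Letter a # T) = (#) a ` lang T"
| "lang (Star B # T) = {u @ v | u v. u \<in> lists B \<and> v \<in> lang T}"

text \<open>
  A word over \<open>B\<close> that avoids \<open>z\<close> is cut at its greedy embedding of a maximal proper prefix of \<open>z\<close>;
  the piece before the letter \<open>a\<close> of \<open>z\<close> is a word over \<open>B - {a}\<close>.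
\<close>

fun splits :: "'a set \<Rightarrow> 'a list \<Rightarrow> 'a factor list set" where
  "splits B [] = {}"
| "splits B (a # z) =
     insert [Star (B - {a})] ((\<lambda>T. Star (B - {a}) # Letter a # T) ` splits B z)"

text \<open>This is the termination measure. Letters do not count, so a refinement may insert any
  number of them.\<close>

fun alphabets :: "'a factor list \<Rightarrow> 'a set multiset" where
  "alphabets [] = {#}"
| "alphabets (Letter a # T) = alphabets T"
| "alphabets (Star B # T) = add_mset B (alphabets T)"

lemma alphabets_append: "alphabets (S @ T) = alphabets S + alphabets T"
  by (induction S rule: alphabets.induct) auto

lemma lang_append: "lang (S @ T) = {u @ v | u v. u \<in> lang S \<and> v \<in> lang T}"
proof (induction S rule: lang.induct)
  case (2 a S)
  have "lang (Letter a # S @ T) = {(a # u) @ v | u v. u \<in> lang S \<and> v \<in> lang T}"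
    using 2 by auto
  also have "\<dots> = {u @ v | u v. u \<in> lang (Letter a # S) \<and> v \<in> lang T}"
    by (simp only: lang.simps) blast
  finally show ?case by simp
next
  case (3 B S)
  show ?case (is "?l = ?r")
  proof (intro equalityI subsetI)
    fix x assume "x \<in> ?l"
    then obtain u v w where x: "x = u @ v @ w" "u \<in> lists B" "v \<in> lang S" "w \<in> lang T"
      using 3 by auto
    hence "u @ v \<in> lang (Star B # S)" by auto
    thus "x \<in> ?r" using x by (metis (mono_tags, lifting) append.assoc mem_Collect_eq)
  next
    fix x assume "x \<in> ?r"
    then obtain y w where y: "x = y @ w" "y \<in> lang (Star B # S)" "w \<in> lang T" by blast
    then obtain u v where "y = u @ v" "u \<in> lists B" "v \<in> lang S" by auto
    with y have x: "x = u @ v @ w" "u \<in> lists B" "v \<in> lang S" "w \<in> lang T" by auto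
    hence "v @ w \<in> lang (S @ T)" using 3 by auto
    thus "x \<in> ?l" using x by auto
  qed
qed auto

lemma finite_splits: "finite (splits B z)"
  by (induction z) auto

text \<open>Every letter of \<open>z\<close> lies in \<open>B\<close>, so deleting it shrinks the
  alphabet strictly.\<close>

lemma alphabets_splits:
  assumes "T \<in> splits B z" "z \<in> lists B" "C \<in># alphabets T"
  shows "C \<subset> B"
  using assms
proof (induction z arbitrary: T)
  case (Cons a z)
  have "B - {a} \<subset> B" using Cons.prems(2) by auto
  moreover have "C = B - {a} \<or> (\<exists>T0 \<in> splits B z. C \<in># alphabets T0)"
    using Cons.prems(1,3) by auto
  moreover have "z \<in> lists B" using Cons.prems(2) by simp
  ultimately show ?case using Cons.IH by blast
qed simp

lemma in_lang_splits:
  assumes "u \<in> lists B" "\<not> subseq z u"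
  shows "\<exists>T \<in> splits B z. u \<in> lang T"
  using assms
proof (induction z arbitrary: u)
  case (Cons a z)
  show ?case
  proof (cases "a \<in> set u")
    case True
    then obtain u1 u2 where u: "u = u1 @ a # u2" "a \<notin> set u1"
      by (meson split_list_first)
    \<comment> \<open>An embedding of \<open>z\<close> into \<open>u2\<close> would extend by the
      \<open>a\<close> in front of \<open>u2\<close> to one of \<open>a # z\<close> into
      \<open>u\<close>.\<close>
    have "\<not> subseq z u2"
      using Cons.prems(2) u(1) by (meson list_emb_append2 subseq_Cons2)
    then obtain T where T: "T \<in> splits B z" "u2 \<in> lang T"
      using Cons.IH[of u2] Cons.prems(1) u by auto
    have "u1 \<in> lists (B - {a})"
      using Cons.prems(1) u by auto
    hence "u \<in> lang (Star (B - {a}) # Letter a # T)"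
      using T u by auto
    moreover have "Star (B - {a}) # Letter a # T \<in> splits B (a # z)"
      using T(1) by simp
    ultimately show ?thesis by blast
  next
    case False
    hence "u \<in> lang [Star (B - {a})]"
      using Cons.prems(1) by auto
    thus ?thesis by auto
  qed
qed auto

text \<open>With \<open>z\<close> factored along \<open>T\<close>, embeddings into matching factors
  concatenate, so a word of \<open>lang T\<close> that avoids \<open>z\<close> fails at some star
  factor. There \<open>splits\<close> replaces the alphabet by proper subsets, and all other factors
  stay.\<close>

lemma refine_avoiding:
  assumes "z \<in> lang T" "\<forall>B \<in># alphabets T. finite B"
  shows "\<exists>G. finite G \<and>
           (\<forall>T'\<in>G. (alphabets T', alphabets T) \<in> mult1 finite_psubset) \<and>
           {u \<in> lang T. \<not> subseq z u} \<subseteq> (\<Union>T'\<in>G. lang T')"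
  using assms
proof (induction T arbitrary: z rule: lang.induct)
  case 1
  \<comment> \<open>Here \<open>z\<close> is empty and embeds in every word, so there is nothing to
    cover.\<close>
  then show ?case by (intro exI[of _ "{}"]) auto
next
  case (2 a T)
  then obtain z' where z': "z = a # z'" "z' \<in> lang T" by auto
  have "\<forall>B \<in># alphabets T. finite B" using "2.prems"(2) by simp
  from "2.IH"[OF z'(2) this] obtain G where G: "finite G"
    "\<forall>T'\<in>G. (alphabets T', alphabets T) \<in> mult1 finite_psubset"
    "{u \<in> lang T. \<not> subseq z' u} \<subseteq> (\<Union>T'\<in>G. lang T')"
    by blast
  show ?case
  proof (intro exI[of _ "(#) (Letter a) ` G"] conjI)
    show "{u \<in> lang (Letter a # T). \<not> subseq z u} \<subseteq> (\<Union>T'\<in>(#) (Letter a) ` G. lang T')"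
    proof
      fix u assume "u \<in> {u \<in> lang (Letter a # T). \<not> subseq z u}"
      then obtain u' where "u = a # u'" "u' \<in> lang T" "\<not> subseq z' u'" using z'(1) by auto
      moreover from this obtain T' where "T' \<in> G" "u' \<in> lang T'" using G(3) by blast
      ultimately show "u \<in> (\<Union>T'\<in>(#) (Letter a) ` G. lang T')" by auto
    qed
  qed (use G in auto)
next
  case (3 B T)
  then obtain z1 z2 where z: "z = z1 @ z2" "z1 \<in> lists B" "z2 \<in> lang T" by auto
  have finB: "finite B" and "\<forall>B \<in># alphabets T. finite B" using "3.prems"(2) by simp_all
  from "3.IH"[OF z(3) this(2)] obtain G where G: "finite G"
    "\<forall>T'\<in>G. (alphabets T', alphabets T) \<in> mult1 finite_psubset"
    "{u \<in> lang T. \<not> subseq z2 u} \<subseteq> (\<Union>T'\<in>G. lang T')"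
    by blast
  let ?G = "(#) (Star B) ` G \<union> (\<lambda>S. S @ T) ` splits B z1"
  show ?case
  proof (intro exI[of _ ?G] conjI ballI)
    show "finite ?G" using G(1) by (simp add: finite_splits)
  next
    fix T' assume "T' \<in> ?G"
    then consider T0 where "T0 \<in> G" "T' = Star B # T0" | S where "S \<in> splits B z1" "T' = S @ T"
      by auto
    thus "(alphabets T', alphabets (Star B # T)) \<in> mult1 finite_psubset"
    proof cases
      case 1
      hence "(alphabets T0, alphabets T) \<in> mult1 finite_psubset" using G by auto
      from mult1_union[OF this, of "{#B#}"] show ?thesis using 1(2) by simp
    next
      case 2
      show ?thesis
      proof (rule mult1I)
        show "alphabets (Star B # T) = add_mset B (alphabets T)" by simp
        show "alphabets T' = alphabets T + alphabets S" by (simp add: 2(2) alphabets_append)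
        show "(C, B) \<in> finite_psubset" if "C \<in># alphabets S" for C
          using alphabets_splits[OF 2(1) z(2) that] finB by (simp add: finite_psubset_def)
      qed
    qed
  next
    show "{u \<in> lang (Star B # T). \<not> subseq z u} \<subseteq> (\<Union>T'\<in>?G. lang T')"
    proof
      fix u assume "u \<in> {u \<in> lang (Star B # T). \<not> subseq z u}"
      then obtain u1 u2 where u: "u = u1 @ u2" "u1 \<in> lists B" "u2 \<in> lang T" "\<not> subseq z u"
        by auto
      hence "\<not> subseq z1 u1 \<or> \<not> subseq z2 u2"
        using z(1) list_emb_append_mono[of "(=)" z1 u1 z2 u2] by auto
      thus "u \<in> (\<Union>T'\<in>?G. lang T')"
      proof
        assume "\<not> subseq z1 u1"
        then obtain S where "S \<in> splits B z1" "u1 \<in> lang S"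
          using in_lang_splits[OF u(2)] by blast
        hence "u \<in> lang (S @ T)" using u by (auto simp: lang_append)
        thus ?thesis using \<open>S \<in> splits B z1\<close> by blast
      next
        assume "\<not> subseq z2 u2"
        then obtain T0 where T0: "T0 \<in> G" "u2 \<in> lang T0" using G(3) u(3) by auto
        hence "u \<in> lang (Star B # T0)" using u by auto
        thus ?thesis using T0(1) by blast
      qed
    qed
  qed
qed

text \<open>
  If some \<open>z \<in> lang T\<close> is not in \<open>L\<close>, then every word of \<open>L\<close> avoids \<open>z\<close>, so \<open>T\<close> can be refined to finitely
  many products with smaller multisets of alphabets.
\<close>

lemma subseq_closed_decomposition:
  assumes closed: "\<And>u w. w \<in> L \<Longrightarrow> subseq u w \<Longrightarrow> u \<in> L"
    and "\<forall>B \<in># alphabets T. finite B"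
  shows "\<exists>F. finite F \<and> lang T \<inter> L \<subseteq> (\<Union>T'\<in>F. lang T') \<and> (\<Union>T'\<in>F. lang T') \<subseteq> L"
  using assms(2)
\<comment> \<open>A step of this relation replaces one alphabet by finitely many proper subsets; it
  is well-founded because strict inclusion of finite sets is.\<close>
proof (induction "alphabets T" arbitrary: T rule: wf_induct_rule[OF wf_mult1[OF wf_finite_psubset]])
  case 1
  show ?case
  proof (cases "lang T \<subseteq> L")
    case True
    thus ?thesis by (intro exI[of _ "{T}"]) auto
  next
    case False
    then obtain z where z: "z \<in> lang T" "z \<notin> L" by auto
    from refine_avoiding[OF z(1) 1(2)] obtain G where G: "finite G"
      "\<forall>T'\<in>G. (alphabets T', alphabets T) \<in> mult1 finite_psubset"
      "{u \<in> lang T. \<not> subseq z u} \<subseteq> (\<Union>T'\<in>G. lang T')" by blast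
    \<comment> \<open>Finiteness must persist for the induction hypothesis to apply: the alphabets
      of \<open>T'\<close> are old ones or proper subsets of an old one.\<close>
    have fin: "\<forall>B \<in># alphabets T'. finite B" if "T' \<in> G" for T'
    proof -
      have "(alphabets T', alphabets T) \<in> mult1 finite_psubset" using G that by auto
      then obtain B M K where M: "alphabets T = add_mset B M" "alphabets T' = M + K"
        "\<And>C. C \<in># K \<Longrightarrow> (C, B) \<in> finite_psubset" unfolding mult1_def by blast
      have "finite C" if "C \<in># K" for C
        using M(3)[OF that] by (auto simp: finite_psubset_def intro: rev_finite_subset)
      thus ?thesis using 1(2) M by auto
    qed
    have "\<forall>T'\<in>G. \<exists>F. finite F \<and> lang T' \<inter> L \<subseteq> (\<Union>S\<in>F. lang S) \<and> (\<Union>S\<in>F. lang S) \<subseteq> L"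
    proof
      fix T' assume T': "T' \<in> G"
      show "\<exists>F. finite F \<and> lang T' \<inter> L \<subseteq> (\<Union>S\<in>F. lang S) \<and> (\<Union>S\<in>F. lang S) \<subseteq> L"
        by (rule 1(1)[OF bspec[OF G(2) T'] fin[OF T']])
    qed
    from bchoice[OF this] obtain H where "\<forall>T'\<in>G. finite (H T') \<and>
        lang T' \<inter> L \<subseteq> (\<Union>S\<in>H T'. lang S) \<and> (\<Union>S\<in>H T'. lang S) \<subseteq> L" ..
    hence H: "finite (H T')" "lang T' \<inter> L \<subseteq> (\<Union>S\<in>H T'. lang S)" "(\<Union>S\<in>H T'. lang S) \<subseteq> L"
      if "T' \<in> G" for T'
      using that by simp_all
    show ?thesis
    proof (intro exI[of _ "\<Union>(H ` G)"] conjI)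
      show "finite (\<Union>(H ` G))" using G(1) H(1) by simp
      show "(\<Union>T'\<in>\<Union>(H ` G). lang T') \<subseteq> L" using H(3) by fast
      show "lang T \<inter> L \<subseteq> (\<Union>T'\<in>\<Union>(H ` G). lang T')"
      proof
        fix u assume u: "u \<in> lang T \<inter> L"
        hence "\<not> subseq z u" using closed[of u z] z(2) by blast
        then obtain T' where T': "T' \<in> G" "u \<in> lang T'" using G(3) u by blast
        hence "u \<in> (\<Union>S\<in>H T'. lang S)" using H(2)[OF T'(1)] u by blast
        thus "u \<in> (\<Union>T'\<in>\<Union>(H ` G). lang T')" using T'(1) by blast
      qed
    qed
  qed
qed

section \<open>Repairing a word of small discrepancy\<close>

definition hamming :: "'a list \<Rightarrow> 'a list \<Rightarrow> nat" where
  "hamming u v = length (filter (\<lambda>(a, b). a \<noteq> b) (zip u v))"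

text \<open>All windows are tested, not only the whole word, so that the bound passes with the same
  \<open>D\<close> to both halves when the words are cut at a common position.\<close>

definition discrepancy_le :: "real \<Rightarrow> 'a list \<Rightarrow> 'a list \<Rightarrow> bool" where
  "discrepancy_le D u v \<longleftrightarrow> (\<forall>i l b. i + l \<le> length u \<longrightarrow>
     \<bar>real (count_list (take l (drop i u)) b) - real (count_list (take l (drop i v)) b)\<bar> \<le> D)"

lemma hamming_append:
  assumes "length u1 = length v1"
  shows "hamming (u1 @ u2) (v1 @ v2) = hamming u1 v1 + hamming u2 v2"
  using assms by (simp add: hamming_def)

lemma discrepancy_le_append:
  assumes "discrepancy_le D (u1 @ u2) (v1 @ v2)" "length u1 = length v1"
  shows "discrepancy_le D u1 v1" "discrepancy_le D u2 v2"
proof -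
  show "discrepancy_le D u1 v1"
    unfolding discrepancy_le_def
  proof (intro allI impI)
    fix i l b assume "i + l \<le> length u1"
    thus "\<bar>real (count_list (take l (drop i u1)) b) - real (count_list (take l (drop i v1)) b)\<bar> \<le> D"
      using assms(1)[unfolded discrepancy_le_def, rule_format, of i l b] assms(2) by auto
  qed
  show "discrepancy_le D u2 v2"
    unfolding discrepancy_le_def
  proof (intro allI impI)
    fix i l b assume "i + l \<le> length u2"
    thus "\<bar>real (count_list (take l (drop i u2)) b) - real (count_list (take l (drop i v2)) b)\<bar> \<le> D"
      using assms(1)[unfolded discrepancy_le_def, rule_format, of "length u1 + i" l b] assms(2)
      by auto
  qed
qed

lemma discrepancy_le_count:
  assumes "discrepancy_le D u v" "length u = length v"
  shows "\<bar>real (count_list u b) - real (count_list v b)\<bar> \<le> D"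
  using assms(1)[unfolded discrepancy_le_def, rule_format, of 0 "length u" b] assms(2) by auto

lemma hamming_map: "hamming (map f v) v = length (filter (\<lambda>c. f c \<noteq> c) v)"
  unfolding hamming_def by (induction v) auto

lemma length_filter_notin:
  assumes "v \<in> lists K" "finite K"
  shows "length (filter (\<lambda>c. c \<notin> B) v) = (\<Sum>b\<in>K - B. count_list v b)"
  using assms(1)
proof (induction v)
  case (Cons a v)
  have "(\<Sum>b\<in>K - B. count_list (a # v) b) = (\<Sum>b\<in>K - B. count_list v b + (if a = b then 1 else 0))"
    by (intro sum.cong) auto
  also have "\<dots> = (\<Sum>b\<in>K - B. count_list v b) + (if a \<in> K - B then 1 else 0)"
    using assms(2) by (simp add: sum.distrib)
  finally show ?case
    using Cons by auto
qed auto

text \<open>A letter outside \<open>B\<close> is absent from \<open>u\<close>, so it occurs at most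
  \<open>D\<close> times in \<open>v\<close>; all such letters are overwritten by one letter of
  \<open>B\<close>.\<close>

lemma repair_star:
  fixes D :: real
  assumes "u \<in> lists B" "v \<in> lists K" "finite K" "length u = length v"
    and "discrepancy_le D u v" "D \<ge> 0"
  shows "\<exists>w \<in> lists B. length w = length v \<and> real (hamming w v) \<le> card K * D"
proof (cases "v = []")
  case True
  thus ?thesis using assms by (intro bexI[of _ "[]"]) (auto simp: hamming_def)
next
  case False
  then obtain b0 where b0: "b0 \<in> B" using assms(1,4) by (cases u) auto
  define f where "f c = (if c \<in> B then c else b0)" for c
  have "hamming (map f v) v = length (filter (\<lambda>c. c \<notin> B) v)"
    unfolding hamming_map by (rule arg_cong[of _ _ length], rule filter_cong) (use b0 in \<open>auto simp: f_def\<close>)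
  hence "real (hamming (map f v) v) = (\<Sum>b\<in>K - B. real (count_list v b))"
    using length_filter_notin[OF assms(2,3)] by simp
  also have "\<dots> \<le> (\<Sum>b\<in>K - B. D)"
  proof (rule sum_mono)
    fix b assume "b \<in> K - B"
    hence "count_list u b = 0" using assms(1) by (auto simp: count_list_0_iff)
    thus "real (count_list v b) \<le> D" using discrepancy_le_count[OF assms(5,4), of b] by auto
  qed
  also have "\<dots> \<le> card K * D"
    using assms(3,6) by (auto intro!: mult_right_mono card_mono)
  finally show ?thesis
    using b0 by (intro bexI[of _ "map f v"]) (auto simp: f_def)
qed

text \<open>The cuts that factor \<open>u\<close> along \<open>T\<close> are applied to
  \<open>v\<close>, and each factor costs at most \<open>card K * D\<close>.\<close>

lemma repair:
  fixes D :: real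
  assumes "u \<in> lang T" "v \<in> lists K" "finite K" "length u = length v"
    and "discrepancy_le D u v" "D \<ge> 0"
  shows "\<exists>w \<in> lang T. length w = length v \<and> real (hamming w v) \<le> length T * (card K * D)"
  using assms(1,2,4,5)
proof (induction T arbitrary: u v rule: lang.induct)
  case 1
  thus ?case by (auto simp: hamming_def)
next
  case (2 a T)
  then obtain u2 where u: "u = [a] @ u2" "u2 \<in> lang T" by auto
  then obtain c v2 where v: "v = [c] @ v2" "c \<in> K" "v2 \<in> lists K" "length u2 = length v2"
    using 2 by (cases v) auto
  have d: "discrepancy_le D [a] [c]" "discrepancy_le D u2 v2"
    using "2.prems"(4) discrepancy_le_append[of D "[a]" u2 "[c]" v2] u v by auto
  obtain w where w: "w \<in> lang T" "length w = length v2"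
    "real (hamming w v2) \<le> length T * (card K * D)"
    using 2(1)[OF u(2) v(3,4) d(2)] by blast
  \<comment> \<open>If \<open>c \<noteq> a\<close>, the counts of \<open>a\<close> in the two
    one-letter words differ by 1, so \<open>D \<ge> 1\<close> pays for the change.\<close>
  have "real (hamming [a] [c]) \<le> D"
    using discrepancy_le_count[OF d(1), of a] assms(6) by (auto simp: hamming_def)
  also have "D \<le> card K * D"
  proof -
    have "card K \<ge> 1" using v(2) assms(3) by (simp add: Suc_le_eq card_gt_0_iff) auto
    thus ?thesis using assms(6) by (simp add: mult_le_cancel_right1)
  qed
  finally have "real (hamming ([a] @ w) v) \<le> length (Letter a # T) * (card K * D)"
    using w(3) unfolding v(1) by (subst hamming_append) (auto simp: algebra_simps)
  thus ?case using w v by (intro bexI[of _ "[a] @ w"]) auto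
next
  case (3 B T)
  then obtain u1 u2 where u: "u = u1 @ u2" "u1 \<in> lists B" "u2 \<in> lang T" by auto
  define v1 v2 where "v1 = take (length u1) v" and "v2 = drop (length u1) v"
  have v: "v = v1 @ v2" "v1 \<in> lists K" "v2 \<in> lists K" "length u1 = length v1" "length u2 = length v2"
    using 3 u unfolding v1_def v2_def by (auto dest: in_set_takeD in_set_dropD)
  have d: "discrepancy_le D u1 v1" "discrepancy_le D u2 v2"
    using "3.prems"(4) discrepancy_le_append[of D u1 u2 v1 v2] u v by auto
  obtain w1 where w1: "w1 \<in> lists B" "length w1 = length v1" "real (hamming w1 v1) \<le> card K * D"
    using repair_star[OF u(2) v(2) assms(3) v(4) d(1) assms(6)] by blast
  obtain w2 where w2: "w2 \<in> lang T" "length w2 = length v2"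
    "real (hamming w2 v2) \<le> length T * (card K * D)"
    using 3(1)[OF u(3) v(3,5) d(2)] by blast
  have "real (hamming (w1 @ w2) v) \<le> length (Star B # T) * (card K * D)"
    using w1(3) w2(3) unfolding v(1) hamming_append[OF w1(2)] by (auto simp: algebra_simps)
  thus ?case using w1 w2 v by (intro bexI[of _ "w1 @ w2"]) auto
qed

section \<open>Row words of permutations\<close>

text \<open>The rows have height \<open>N div k + 1\<close>, so that at most \<open>k\<close> of them are needed.\<close>

definition row :: "nat \<Rightarrow> nat \<Rightarrow> nat \<Rightarrow> nat" where
  "row k N y = (y - 1) div (N div k + 1)"

definition row_word :: "nat \<Rightarrow> perm \<Rightarrow> nat list" where
  "row_word k \<pi> = map (\<lambda>x. row k (perm_order \<pi>) (app \<pi> x)) [1..<Suc (perm_order \<pi>)]"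

lemma row_mono: "y \<le> y' \<Longrightarrow> row k N y \<le> row k N y'"
  by (simp add: row_def div_le_mono)

lemma row_less:
  assumes "k > 0" "y \<in> {1..N}"
  shows "row k N y < k"
proof -
  have "N < k * (N div k + 1)"
    using assms(1) by (metis add.commute dividend_less_times_div mult_Suc_right plus_1_eq_Suc)
  hence "y - 1 < k * (N div k + 1)" using assms(2) by auto
  thus ?thesis by (simp add: row_def less_mult_imp_div_less)
qed

lemma row_eq_iff:
  assumes "y \<ge> 1"
  shows "row k N y = b \<longleftrightarrow> y \<in> {b * (N div k + 1) + 1..(b + 1) * (N div k + 1)}"
proof -
  have q: "N div k + 1 > 0" by simp
  have "row k N y = b \<longleftrightarrow> b \<le> (y - 1) div (N div k + 1) \<and> (y - 1) div (N div k + 1) < b + 1"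
    unfolding row_def by auto
  also have "\<dots> \<longleftrightarrow> b * (N div k + 1) \<le> y - 1 \<and> y - 1 < (b + 1) * (N div k + 1)"
    unfolding div_less_iff_less_mult[OF q] less_eq_div_iff_mult_less_eq[OF q] ..
  finally show ?thesis using assms by auto
qed

lemma app_in:
  assumes "\<pi> \<in> permutations" "x \<in> {1..perm_order \<pi>}"
  shows "app \<pi> x \<in> {1..perm_order \<pi>}"
  using assms permutes_in_image by (fastforce simp: permutations_def perm_order_def app_def)

lemma app_inj:
  assumes "\<pi> \<in> permutations"
  shows "inj (app \<pi>)"
  using assms permutes_inj by (fastforce simp: permutations_def app_def)

lemma row_word_nth:
  assumes "i \<in> {1..perm_order \<pi>}"
  shows "row_word k \<pi> ! (i - 1) = row k (perm_order \<pi>) (app \<pi> i)"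
  using assms by (auto simp: row_word_def simp del: upt_Suc)

lemma length_row_word: "length (row_word k \<pi>) = perm_order \<pi>"
  by (simp add: row_word_def)

section \<open>Rectangular distance and discrepancy of row words\<close>

text \<open>The letter \<open>b\<close> stands for an interval of values, so its count in a window
  is a rectangle count. The topmost row may stick out of the range, hence the
  \<open>min\<close>.\<close>

lemma count_row_word:
  assumes "\<pi> \<in> permutations" "i + l \<le> perm_order \<pi>"
  defines "N \<equiv> perm_order \<pi>"
  shows "count_list (take l (drop i (row_word k \<pi>))) b =
    card (app \<pi> ` {i + 1..i + l} \<inter> {b * (N div k + 1) + 1..min N ((b + 1) * (N div k + 1))})"
proof -
  have count_map: "count_list (map f xs) c = length (filter (\<lambda>x. f x = c) xs)"
    for f :: "nat \<Rightarrow> nat" and xs c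
    by (induction xs) auto
  have "take l (drop i (row_word k \<pi>)) = map (\<lambda>x. row k N (app \<pi> x)) [i + 1..<i + l + 1]"
    using assms(2) by (simp add: row_word_def take_map drop_map N_def del: upt_Suc)
  hence "count_list (take l (drop i (row_word k \<pi>))) b =
      length (filter (\<lambda>x. row k N (app \<pi> x) = b) [i + 1..<i + l + 1])"
    by (simp only: count_map)
  also have "\<dots> = card (set (filter (\<lambda>x. row k N (app \<pi> x) = b) [i + 1..<i + l + 1]))"
    by (rule distinct_card[symmetric]) (simp del: upt_Suc)
  also have "\<dots> = card (app \<pi> ` {x \<in> {i + 1..i + l}. row k N (app \<pi> x) = b})"
    by (subst card_image[OF inj_on_subset[OF app_inj[OF assms(1)]]])
       (auto intro!: arg_cong[of _ _ card])
  also have "app \<pi> ` {x \<in> {i + 1..i + l}. row k N (app \<pi> x) = b} =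
      app \<pi> ` {i + 1..i + l} \<inter> {b * (N div k + 1) + 1..min N ((b + 1) * (N div k + 1))}"
  proof -
    have "row k N (app \<pi> x) = b \<longleftrightarrow>
        app \<pi> x \<in> {b * (N div k + 1) + 1..min N ((b + 1) * (N div k + 1))}"
      if "x \<in> {i + 1..i + l}" for x
    proof -
      have "app \<pi> x \<in> {1..N}" using app_in[OF assms(1), of x] that assms(2) N_def by auto
      thus ?thesis using row_eq_iff[of "app \<pi> x" k N b] by auto
    qed
    thus ?thesis by blast
  qed
  finally show ?thesis .
qed

lemma le_dist_rect:
  assumes "S \<in> subintervals (perm_order \<pi>)" "T \<in> subintervals (perm_order \<pi>)"
  shows "\<bar>real (card (app \<pi> ` S \<inter> T)) - real (card (app \<sigma> ` S \<inter> T))\<bar> / real (perm_order \<pi>)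
    \<le> dist_rect \<pi> \<sigma>"
  unfolding dist_rect_def
proof (rule Max_ge)
  let ?I = "subintervals (perm_order \<pi>)"
  have "?I \<subseteq> Pow {1..perm_order \<pi>}" by (auto simp: subintervals_def)
  hence "finite (?I \<times> ?I)" using finite_subset by blast
  hence "finite ((\<lambda>(S, T). \<bar>real (card (app \<pi> ` S \<inter> T)) - real (card (app \<sigma> ` S \<inter> T))\<bar>
      / real (perm_order \<pi>)) ` (?I \<times> ?I))" by (rule finite_imageI)
  thus "finite {\<bar>real (card (app \<pi> ` S \<inter> T)) - real (card (app \<sigma> ` S \<inter> T))\<bar>
      / real (perm_order \<pi>) | S T. S \<in> ?I \<and> T \<in> ?I}"
    by (rule rev_finite_subset) auto
qed (use assms in blast)

lemma discrepancy_row_word: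
  assumes "\<pi> \<in> permutations" "\<sigma> \<in> permutations" "perm_order \<sigma> = perm_order \<pi>"
    and "dist_rect \<pi> \<sigma> \<le> \<delta>"
  shows "discrepancy_le (\<delta> * perm_order \<pi>) (row_word k \<sigma>) (row_word k \<pi>)"
  unfolding discrepancy_le_def
proof (intro allI impI)
  fix i l :: nat and b
  let ?N = "perm_order \<pi>"
  let ?S = "{i + 1..i + l}" and ?T = "{b * (?N div k + 1) + 1..min ?N ((b + 1) * (?N div k + 1))}"
  assume "i + l \<le> length (row_word k \<sigma>)"
  hence il: "i + l \<le> ?N" using assms(3) by (simp add: length_row_word)
  have N: "?N > 0" using assms(1) by (auto simp: permutations_def perm_order_def)
  have sub: "{a..c} \<in> subintervals ?N" if "1 \<le> a" "c \<le> ?N" for a c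
    using that unfolding subintervals_def by blast
  have "?S \<in> subintervals ?N" "?T \<in> subintervals ?N"
    by (rule sub; use il in simp)+
  from order_trans[OF le_dist_rect[OF this, of \<sigma>] assms(4)]
  have "\<bar>real (card (app \<pi> ` ?S \<inter> ?T)) - real (card (app \<sigma> ` ?S \<inter> ?T))\<bar> \<le> \<delta> * ?N"
    using N by (simp only: pos_divide_le_eq of_nat_0_less_iff)
  thus "\<bar>real (count_list (take l (drop i (row_word k \<sigma>))) b) -
      real (count_list (take l (drop i (row_word k \<pi>))) b)\<bar> \<le> \<delta> * ?N"
    using count_row_word[OF assms(1) il, of k b] count_row_word[OF assms(2), of i l k b] il assms(3)
    by (simp add: abs_minus_commute)
qed

section \<open>Realising words of the language inside the property\<close>

text \<open>The rank of \<open>g i\<close> among the values of \<open>g\<close> serves as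
  \<open>p i\<close>; ranks count \<open>g i\<close> itself and so start at 1.\<close>

lemma exists_pattern:
  fixes g :: "nat \<Rightarrow> nat"
  assumes "inj_on g {1..n}"
  shows "\<exists>p. p permutes {1..n} \<and> (\<forall>i\<in>{1..n}. \<forall>j\<in>{1..n}. p i < p j \<longleftrightarrow> g i < g j)"
proof -
  define r where "r i = card {j \<in> {1..n}. g j \<le> g i}" for i
  define p where "p i = (if i \<in> {1..n} then r i else i)" for i
  have less: "r i < r j" if "j \<in> {1..n}" "g i < g j" for i j
    unfolding r_def
  proof (rule psubset_card_mono)
    have "j \<in> {j' \<in> {1..n}. g j' \<le> g j} - {j' \<in> {1..n}. g j' \<le> g i}" using that by auto
    moreover have "{j' \<in> {1..n}. g j' \<le> g i} \<subseteq> {j' \<in> {1..n}. g j' \<le> g j}" using that by auto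
    ultimately show "{j' \<in> {1..n}. g j' \<le> g i} \<subset> {j' \<in> {1..n}. g j' \<le> g j}" by blast
  qed auto
  have le: "r i \<le> r j" if "g i \<le> g j" for i j
    unfolding r_def by (rule card_mono) (use that in auto)
  have iff: "r i < r j \<longleftrightarrow> g i < g j" if "j \<in> {1..n}" for i j
    using less[OF that] le[of j i] by (meson linorder_not_le)
  have inj: "inj_on p {1..n}"
  proof (rule inj_onI)
    fix i j assume ij: "i \<in> {1..n}" "j \<in> {1..n}" "p i = p j"
    hence "g i = g j" using less[of i j] less[of j i] unfolding p_def
      by (metis linorder_neqE_nat order_less_irrefl)
    thus "i = j" using assms ij by (auto dest: inj_onD)
  qed
  have "p ` {1..n} \<subseteq> {1..n}"
  proof
    fix y assume "y \<in> p ` {1..n}"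
    then obtain i where i: "i \<in> {1..n}" "y = r i" by (auto simp: p_def)
    have "r i \<le> card {1..n}" unfolding r_def by (rule card_mono) auto
    moreover have "r i > 0" unfolding r_def using i by (auto simp: card_gt_0_iff)
    ultimately show "y \<in> {1..n}" using i by auto
  qed
  hence "bij_betw p {1..n} {1..n}"
    using inj by (simp add: bij_betw_def endo_inj_surj)
  hence "p permutes {1..n}" by (rule bij_imp_permutes) (auto simp: p_def)
  thus ?thesis using iff by (intro exI[of _ p]) (auto simp: p_def)
qed

text \<open>The positions of \<open>w\<close> in the row word induce a subpermutation of
  \<open>\<rho>\<close>, which heredity keeps in \<open>\<P>\<close>; a smaller row means a smaller
  value. Equal letters leave the order open, so only one implication is claimed.\<close>

lemma realise_subseq_row_word:
  assumes "\<P> \<subseteq> permutations" "hereditary \<P>" "\<rho> \<in> \<P>"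
    and "subseq w (row_word k \<rho>)" "w \<noteq> []"
  shows "\<exists>\<tau>\<in>\<P>. perm_order \<tau> = length w \<and>
    (\<forall>i\<in>{1..length w}. \<forall>j\<in>{1..length w}. w ! (i - 1) < w ! (j - 1) \<longrightarrow> app \<tau> i < app \<tau> j)"
proof -
  let ?M = "perm_order \<rho>"
  have \<rho>: "\<rho> \<in> permutations" using assms by auto
  obtain I where w: "w = nths (row_word k \<rho>) I" using assms(4) by (auto simp: subseq_conv_nths)
  \<comment> \<open>\<open>ys\<close> lists the chosen positions in increasing order, so
    \<open>nth_elem X\<close> reads off its entries.\<close>
  define ys where "ys = nths [1..<Suc ?M] I"
  define X where "X = set ys"
  have wys: "w = map (\<lambda>x. row k ?M (app \<rho> x)) ys"
    by (simp add: w ys_def row_word_def nths_map del: upt_Suc)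
  have "sorted ys" "distinct ys"
    by (auto simp: ys_def intro!: sorted_nths distinct_nthsI simp del: upt_Suc)
  hence ysX: "sorted_list_of_set X = ys" and cX: "card X = length w"
    unfolding X_def by (auto simp: sorted_list_of_set.idem_if_sorted_distinct wys distinct_card)
  have XM: "X \<subseteq> {1..?M}"
    using set_nths_subset[of "[1..<Suc ?M]" I] unfolding X_def ys_def by (auto simp del: upt_Suc)
  let ?n = "length w"
  have nth: "nth_elem X i = ys ! (i - 1)" for i by (simp add: nth_elem_def ysX)
  have "inj_on (\<lambda>i. app \<rho> (nth_elem X i)) {1..?n}"
  proof (rule inj_onI)
    fix i j assume ij: "i \<in> {1..?n}" "j \<in> {1..?n}" "app \<rho> (nth_elem X i) = app \<rho> (nth_elem X j)"
    hence "ys ! (i - 1) = ys ! (j - 1)" using app_inj[OF \<rho>] by (auto simp: nth dest: injD)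
    hence "i - 1 = j - 1"
      using ij wys \<open>distinct ys\<close> by (subst (asm) nth_eq_iff_index_eq) auto
    thus "i = j" using ij by auto
  qed
  from exists_pattern[OF this] obtain p where p: "p permutes {1..?n}"
    "\<And>i j. i \<in> {1..?n} \<Longrightarrow> j \<in> {1..?n} \<Longrightarrow>
       p i < p j \<longleftrightarrow> app \<rho> (nth_elem X i) < app \<rho> (nth_elem X j)" by blast
  have n: "?n \<ge> 1" using assms(5) by (simp add: Suc_le_eq)
  have "induced_subperm \<rho> X (?n, p)"
    using p n XM cX by (auto simp: induced_subperm_def permutations_def perm_order_def app_def)
  hence "(?n, p) \<in> \<P>" using assms(2,3) by (auto simp: hereditary_def)
  moreover have "p i < p j"
    if "i \<in> {1..?n}" "j \<in> {1..?n}" "w ! (i - 1) < w ! (j - 1)" for i j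
  proof -
    have "row k ?M (app \<rho> (ys ! (i - 1))) < row k ?M (app \<rho> (ys ! (j - 1)))"
      using that wys by auto
    hence "app \<rho> (ys ! (i - 1)) < app \<rho> (ys ! (j - 1))"
      using row_mono by (meson linorder_not_le)
    thus ?thesis using p(2)[OF that(1,2)] by (simp add: nth)
  qed
  ultimately show ?thesis
    by (intro bexI[of _ "(?n, p)"]) (auto simp: perm_order_def app_def)
qed

section \<open>Kendall's tau distance from Hamming distance\<close>

lemma hamming_eq_card:
  assumes "length w = length v"
  shows "hamming w v = card {i \<in> {1..length v}. w ! (i - 1) \<noteq> v ! (i - 1)}"
proof -
  have "hamming w v = card {i. i < length v \<and> w ! i \<noteq> v ! i}"
    unfolding hamming_def length_filter_conv_card
    by (rule arg_cong[of _ _ card]) (use assms in auto)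
  also have "\<dots> = card (Suc ` {i. i < length v \<and> w ! i \<noteq> v ! i})"
    by (simp add: card_image)
  also have "Suc ` {i. i < length v \<and> w ! i \<noteq> v ! i} =
      {i \<in> {1..length v}. w ! (i - 1) \<noteq> v ! (i - 1)}"
  proof (intro equalityI subsetI)
    fix i assume "i \<in> {i \<in> {1..length v}. w ! (i - 1) \<noteq> v ! (i - 1)}"
    thus "i \<in> Suc ` {i. i < length v \<and> w ! i \<noteq> v ! i}"
      by (intro image_eqI[of _ _ "i - 1"]) auto
  qed auto
  finally show ?thesis .
qed

text \<open>A row holds \<open>N div k + 1\<close> values, one of which is taken by \<open>i\<close>
  itself.\<close>

lemma card_same_row:
  assumes "\<pi> \<in> permutations" "i \<in> {1..perm_order \<pi>}"
  defines "N \<equiv> perm_order \<pi>"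
  shows "card {j \<in> {1..N}. j \<noteq> i \<and> row k N (app \<pi> j) = row k N (app \<pi> i)} \<le> N div k"
proof -
  let ?J = "{j \<in> {1..N}. j \<noteq> i \<and> row k N (app \<pi> j) = row k N (app \<pi> i)}"
  let ?q = "N div k + 1" and ?b = "row k N (app \<pi> i)"
  let ?R = "{?b * ?q + 1..(?b + 1) * ?q}"
  have mem: "app \<pi> j \<in> ?R" if "j \<in> {1..N}" "row k N (app \<pi> j) = ?b" for j
  proof -
    have "app \<pi> j \<ge> 1" using app_in[OF assms(1), of j] that N_def by auto
    from row_eq_iff[OF this, of k N ?b] that(2) show ?thesis by blast
  qed
  have "app \<pi> ` ?J \<subseteq> ?R - {app \<pi> i}"
    using mem app_inj[OF assms(1)] by (auto simp del: atLeastAtMost_iff dest: injD)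
  hence "card (app \<pi> ` ?J) \<le> card (?R - {app \<pi> i})" by (intro card_mono) auto
  also have "\<dots> = N div k"
    using mem[of i] assms(2) N_def by (subst card_Diff_singleton) auto
  finally show ?thesis
    by (simp add: card_image[OF inj_on_subset[OF app_inj[OF assms(1)]]])
qed

text \<open>A discordant pair lies in a single row of \<open>\<pi>\<close> or contains a position where \<open>w\<close> was changed.\<close>

lemma dist_kendall_le:
  assumes "\<pi> \<in> permutations" "perm_order \<pi> \<ge> 2" "k > 0"
    and "length w = perm_order \<pi>"
    and resp: "\<And>i j. i \<in> {1..perm_order \<pi>} \<Longrightarrow> j \<in> {1..perm_order \<pi>} \<Longrightarrow>
           w ! (i - 1) < w ! (j - 1) \<Longrightarrow> app \<tau> i < app \<tau> j"
  shows "dist_kendall \<pi> \<tau> \<le> 4 / k + 8 * hamming w (row_word k \<pi>) / perm_order \<pi>"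
proof -
  define N where "N = perm_order \<pi>"
  define v where "v = row_word k \<pi>"
  define h where "h = hamming w v"
  let ?I = "{1..N}"
  let ?H = "{i \<in> ?I. w ! (i - 1) \<noteq> v ! (i - 1)}"
  let ?A = "Sigma ?I (\<lambda>i. {j \<in> ?I. j \<noteq> i \<and> row k N (app \<pi> j) = row k N (app \<pi> i)})"
  let ?D = "{(i, j). i \<in> ?I \<and> j \<in> ?I \<and> app \<pi> i < app \<pi> j \<and> app \<tau> i > app \<tau> j}"
  have H: "card ?H = h"
    using hamming_eq_card[of w v] assms(4) by (simp add: h_def v_def length_row_word N_def)
  have "?D \<subseteq> ?A \<union> (?H \<times> ?I \<union> ?I \<times> ?H)"
  proof (rule subsetI, rule ccontr)
    fix x assume x: "x \<in> ?D" "x \<notin> ?A \<union> (?H \<times> ?I \<union> ?I \<times> ?H)"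
    obtain i j where ij: "x = (i, j)" "i \<in> ?I" "j \<in> ?I" "app \<pi> i < app \<pi> j" "app \<tau> i > app \<tau> j"
      using x(1) by blast
    have "row k N (app \<pi> i) \<noteq> row k N (app \<pi> j)" using x(2) ij by auto
    hence "row k N (app \<pi> i) < row k N (app \<pi> j)"
      using row_mono[of "app \<pi> i" "app \<pi> j" k N] ij(4) by simp
    moreover have "w ! (i - 1) = v ! (i - 1)" "w ! (j - 1) = v ! (j - 1)" using x(2) ij by auto
    ultimately have "w ! (i - 1) < w ! (j - 1)"
      using ij(2,3) row_word_nth[of i \<pi> k] row_word_nth[of j \<pi> k] by (simp add: v_def N_def)
    hence "app \<tau> i < app \<tau> j" using resp ij N_def by blast
    thus False using ij by simp
  qed
  hence "card ?D \<le> card (?A \<union> (?H \<times> ?I \<union> ?I \<times> ?H))" by (rule card_mono[rotated]) auto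
  also have "\<dots> \<le> card ?A + (card (?H \<times> ?I) + card (?I \<times> ?H))"
    by (meson add_left_mono card_Un_le order_trans)
  also have "card ?A \<le> N * (N div k)"
  proof -
    have "card ?A = (\<Sum>i\<in>?I. card {j \<in> ?I. j \<noteq> i \<and> row k N (app \<pi> j) = row k N (app \<pi> i)})"
      by (rule card_SigmaI) auto
    also have "\<dots> \<le> (\<Sum>i\<in>?I. N div k)"
      by (rule sum_mono) (use card_same_row[OF assms(1)] N_def in auto)
    finally show ?thesis by simp
  qed
  also have "card (?H \<times> ?I) + card (?I \<times> ?H) = 2 * h * N"
    unfolding card_cartesian_product H by simp
  finally have "card ?D \<le> N * (N div k) + 2 * h * N" by simp
  hence "real (card ?D) \<le> real (N * (N div k) + 2 * h * N)" by (simp only: of_nat_le_iff)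
  also have "\<dots> = N * real (N div k) + 2 * h * N" by simp
  also have "\<dots> \<le> N * (N / k) + 2 * h * N"
    by (intro add_right_mono mult_left_mono of_nat_div_le_of_nat) auto
  finally have D: "real (card ?D) \<le> N * (N / k) + 2 * h * N" .
  have N2: "N \<ge> 2" using assms(2) N_def by simp
  \<comment> \<open>For \<open>N \<ge> 2\<close> the binomial coefficient is at least
    \<open>N * N / 4\<close>; measuring both error terms in this unit gives the constants 4 and
    8.\<close>
  have "N * (N / k) + 2 * h * N = (4 / k + 8 * h / N) * (real N * N / 4)"
    using N2 assms(3) by (simp add: field_simps)
  also have "\<dots> \<le> (4 / k + 8 * h / N) * real (N choose 2)"
  proof (rule mult_left_mono)
    have "2 * real N \<le> real N * N" using N2 by (intro mult_right_mono) auto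
    hence "real N * N \<le> 2 * (real N * (real N - 1))" by (simp add: algebra_simps)
    also have "real N * (real N - 1) = real (N * (N - 1))"
      using N2 by simp
    also have "N * (N - 1) = 2 * (N choose 2)"
    proof -
      have "even (N * (N - 1))" using N2 by (cases "even N") auto
      thus ?thesis unfolding choose_two by simp
    qed
    finally show "real N * N / 4 \<le> real (N choose 2)" by simp
  qed auto
  finally have "real (card ?D) \<le> (4 / k + 8 * h / N) * real (N choose 2)" using D by simp
  moreover have "N choose 2 > 0" using N2 by (simp add: zero_less_binomial)
  ultimately have "real (card ?D) / real (N choose 2) \<le> 4 / k + 8 * h / N"
    by (simp add: pos_divide_le_eq)
  thus ?thesis unfolding dist_kendall_def N_def h_def v_def by simp
qed

section \<open>Choice of the constants and conclusion\<close>

theorem theorem7: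
  fixes \<P> :: "perm set"
  assumes "permutation_property \<P>"
    and "hereditary \<P>"
  shows "\<forall>\<epsilon>\<^sub>0::real. \<epsilon>\<^sub>0 > 0 \<longrightarrow> (\<exists>\<delta>\<^sub>0::real. \<delta>\<^sub>0 > 0 \<and>
           (\<forall>\<pi>\<in>permutations.
              dist_rect_prop \<pi> \<P> < ereal \<delta>\<^sub>0 \<longrightarrow> dist_kendall_prop \<pi> \<P> < ereal \<epsilon>\<^sub>0))"
proof (intro allI impI)
  fix \<epsilon> :: real assume \<epsilon>: "\<epsilon> > 0"
  have P: "\<P> \<subseteq> permutations" using assms(1) by (simp add: permutation_property_def)
  \<comment> \<open>This makes the cost \<open>4 / k\<close> of pairs within a row less than half of
    \<open>\<epsilon>\<close>.\<close>
  obtain k :: nat where k: "8 / \<epsilon> < k" using reals_Archimedean2 by blast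
  hence k0: "k > 0" using \<epsilon> by (cases k) (auto simp: divide_less_0_iff)
  have k4: "4 / k < \<epsilon> / 2" using k \<epsilon> k0 by (simp add: field_simps)
  define L where "L = {w. \<exists>\<rho>\<in>\<P>. subseq w (row_word k \<rho>)}"
  have closed: "u \<in> L" if "w \<in> L" "subseq u w" for u w
    using that unfolding L_def by (auto intro: subseq_order.trans)
  \<comment> \<open>Row words only use letters below \<open>k\<close>, so one star over
    \<open>{..<k}\<close> covers those of \<open>\<P>\<close>.\<close>
  obtain F where F: "finite F" "lang [Star {..<k}] \<inter> L \<subseteq> (\<Union>T\<in>F. lang T)" "(\<Union>T\<in>F. lang T) \<subseteq> L"
    using subseq_closed_decomposition[of L "[Star {..<k}]"] closed by auto
  \<comment> \<open>The number of factors is bounded before any \<open>\<pi>\<close> is given, which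
    makes \<open>\<delta>\<close> uniform.\<close>
  obtain m where m: "\<And>T. T \<in> F \<Longrightarrow> length T \<le> m"
    using F(1) by (metis finite_imageI finite_nat_set_iff_bounded_le image_eqI)
  define c where "c = real (Suc m)"
  have c: "c > 0" by (simp add: c_def)
  \<comment> \<open>At most \<open>c\<close> factors, each repaired at cost
    \<open>k * (\<delta> * N)\<close>, change at most \<open>\<epsilon> / 16 * N\<close> letters;
    the factor 8 in the Kendall bound turns this into \<open>\<epsilon> / 2\<close>.\<close>
  define \<delta> where "\<delta> = \<epsilon> / (16 * c * k)"
  have \<delta>: "\<delta> > 0" using \<epsilon> k0 c by (simp add: \<delta>_def)
  have words: "row_word k \<pi> \<in> lists {..<k}" if "\<pi> \<in> permutations" for \<pi>
    using app_in[OF that] row_less[OF k0] by (auto simp: row_word_def)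
  show "\<exists>\<delta>\<^sub>0>0. \<forall>\<pi>\<in>permutations. dist_rect_prop \<pi> \<P> < ereal \<delta>\<^sub>0 \<longrightarrow>
      dist_kendall_prop \<pi> \<P> < ereal \<epsilon>"
  proof (intro exI[of _ \<delta>] conjI ballI impI \<delta>)
    fix \<pi> assume \<pi>: "\<pi> \<in> permutations" and "dist_rect_prop \<pi> \<P> < ereal \<delta>"
    then obtain \<sigma> where \<sigma>: "\<sigma> \<in> \<P>" "perm_order \<sigma> = perm_order \<pi>" "dist_rect \<pi> \<sigma> < \<delta>"
      unfolding dist_rect_prop_def by (auto simp: INF_less_iff)
    have \<sigma>p: "\<sigma> \<in> permutations" using \<sigma> P by auto
    define N where "N = perm_order \<pi>"
    have N: "N \<ge> 1" using \<pi> by (auto simp: N_def permutations_def perm_order_def)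
    have "row_word k \<sigma> \<in> lang [Star {..<k}] \<inter> L"
      using words[OF \<sigma>p] \<sigma>(1) by (auto simp: L_def)
    then obtain T where T: "T \<in> F" "row_word k \<sigma> \<in> lang T" using F(2) by auto
    obtain w where w: "w \<in> lang T" "length w = length (row_word k \<pi>)"
      "real (hamming w (row_word k \<pi>)) \<le> length T * (card {..<k} * (\<delta> * N))"
      using repair[OF T(2) words[OF \<pi>], of "\<delta> * N"]
        discrepancy_row_word[OF \<pi> \<sigma>p \<sigma>(2), of \<delta> k] \<sigma> \<delta>
      by (auto simp: N_def length_row_word)
    have lw: "length w = N" using w(2) by (simp add: length_row_word N_def)
    \<comment> \<open>The repair stays in the same product, whose language lies inside
      \<open>L\<close>; hence \<open>w\<close> can be realised in \<open>\<P>\<close>.\<close>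
    have "w \<in> L" using w T F(3) by blast
    then obtain \<rho> where "\<rho> \<in> \<P>" "subseq w (row_word k \<rho>)" by (auto simp: L_def)
    then obtain \<tau> where \<tau>: "\<tau> \<in> \<P>" "perm_order \<tau> = N"
      "\<And>i j. i \<in> {1..N} \<Longrightarrow> j \<in> {1..N} \<Longrightarrow> w ! (i - 1) < w ! (j - 1) \<Longrightarrow> app \<tau> i < app \<tau> j"
      using realise_subseq_row_word[OF P assms(2), of \<rho> w k] lw N by fastforce
    have "dist_kendall \<pi> \<tau> < \<epsilon>"
    proof (cases "N = 1")
      case True
      \<comment> \<open>Here \<open>N choose 2\<close> is 0 and division by zero gives distance
        0.\<close>
      thus ?thesis using \<epsilon> by (simp add: dist_kendall_def N_def binomial_eq_0)
    next
      case False
      hence N2: "perm_order \<pi> \<ge> 2" using N N_def by simp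
      have "real (hamming w (row_word k \<pi>)) \<le> length T * (k * (\<delta> * N))"
        using w(3) by simp
      also have "\<dots> \<le> c * (k * (\<delta> * N))"
        using m[OF T(1)] \<delta> by (intro mult_right_mono) (auto simp: c_def)
      also have "\<dots> = \<epsilon> / 16 * N" using k0 c by (simp add: \<delta>_def)
      finally have "8 * hamming w (row_word k \<pi>) / N \<le> \<epsilon> / 2"
        using N by (simp add: field_simps)
      moreover have "dist_kendall \<pi> \<tau> \<le> 4 / k + 8 * hamming w (row_word k \<pi>) / N"
        using dist_kendall_le[OF \<pi> N2 k0, of w \<tau>] \<tau>(3) lw N_def by simp
      ultimately show ?thesis using k4 by linarith
    qed
    hence "ereal (dist_kendall \<pi> \<tau>) < ereal \<epsilon>" by simp
    moreover have "dist_kendall_prop \<pi> \<P> \<le> ereal (dist_kendall \<pi> \<tau>)"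
      unfolding dist_kendall_prop_def using \<tau>(1,2) N_def by (intro INF_lower) auto
    ultimately show "dist_kendall_prop \<pi> \<P> < ereal \<epsilon>" by (rule le_less_trans[rotated])
  qed
qed

end
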